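(* Let $P$ be a lattice $3$-polytope of size at least seven which is boxed with respect to the unit cube $[0,1]^3$ (with defining functionals $x,y,z$), so that $(P\cap\mathbb{Z}^3)\setminus[0,1]^3=\{v_1,v_2,v_3\}$ where $v_1=(a_1,\lambda^1_y,\lambda^1_z)$, $v_2=(\lambda^2_x,a_2,\lambda^2_z)$, $v_3=(\lambda^3_x,\lambda^3_y,a_3)$ with all $\lambda^i_*\in\{0,1\}$ and $a_i\in\mathbb{Z}\setminus\{0,1\}$. Then $a_i\in\{-6,-5,-4,-3,-2,-1,2,3,4,5,6,7\}$ for all $i\in\{1,2,3\}$.
   Context: A lattice polytope has vertices in $\mathbb{Z}^3$; its size is $|P\cap\mathbb{Z}^3|$. An affine functional $f$ is integer if $f(\mathbb{Z}^3)\subseteq\mathbb{Z}$. Width of $P$: minimum over non-constant integer affine $f$ of $\max_P f-\min_P f$. A lattice $3$-polytope $P$ of width larger than one is boxed with respect to $[0,1]^3=\bigcap_{i}f_i^{-1}([0,1])$ with $f_1=x,f_2=y,f_3=z$ if $(P\cap\mathbb{Z}^3)\setminus[0,1]^3=\{v_1,v_2,v_3\}$ with $f_i(v_j)\notin\{0,1\}$ if and only if $i=j$. *)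

theory Defs
  imports "HOL-Analysis.Analysis"
begin

definition int_lattice :: "(real ^ 'n) set" where
  "int_lattice = {x. \<forall>i. x $ i \<in> \<int>}"

definition lattice_polytope :: "(real ^ 'n) set \<Rightarrow> bool" where
  "lattice_polytope P \<longleftrightarrow> polytope P \<and> {x. x extreme_point_of P} \<subseteq> int_lattice"

definition lattice_size :: "(real ^ 'n) set \<Rightarrow> nat" where
  "lattice_size P = card (P \<inter> int_lattice)"

definition integer_affine :: "(real ^ 'n \<Rightarrow> real) \<Rightarrow> bool" where
  "integer_affine f \<longleftrightarrow>
     (\<exists>g c. linear g \<and> f = (\<lambda>x. g x + c)) \<and> f ` int_lattice \<subseteq> \<int>"

(* For a nonempty lattice polytope P, Sup and Inf over P are attained because P is compact, and
   the outer Inf is a minimum: the values are nonnegative integers, since an affine functional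
   attains its extrema over P at vertices. *)
definition lattice_width :: "(real ^ 'n) set \<Rightarrow> real" where
  "lattice_width P =
     Inf {Sup (f ` P) - Inf (f ` P) | f. integer_affine f \<and> \<not> f constant_on UNIV}"

definition unit_cube :: "(real ^ 3) set" where
  "unit_cube = (\<Inter>i. (\<lambda>x. x $ i) -` {0..1})"

(* The functional f_i is the i-th coordinate, so f_i(v_j) is v j $ i. The condition on
   the v_j makes them pairwise distinct. *)
definition boxed_unit_cube :: "(real ^ 3) set \<Rightarrow> bool" where
  "boxed_unit_cube P \<longleftrightarrow>
     lattice_polytope P \<and> aff_dim P = 3 \<and> lattice_width P > 1 \<and>
     (\<exists>v :: 3 \<Rightarrow> real ^ 3.
        (P \<inter> int_lattice) - unit_cube = {v 1, v 2, v 3} \<and>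
        (\<forall>i j. v j $ i \<notin> {0, 1} \<longleftrightarrow> i = j))"

end

theory Submission
  imports Defs
begin

text \<open>
  Suppose \<open>a\<^sub>1 \<ge> 8\<close>; after reflections, \<open>v\<^sub>1 = (a\<^sub>1, 0, 0)\<close>. Consider the fibres of \<open>P\<close> along the
  \<open>x\<close>-axis. Apart from \<open>v\<^sub>1\<close>, the lattice points of \<open>P\<close> over \<open>{0, 1}\<^sup>2\<close> have \<open>x \<in> {0, 1}\<close>, so no
  fibre over a point of \<open>{0, 1}\<^sup>2\<close> contains both points with \<open>x \<le> 1\<close> and points with \<open>x \<ge> 2\<close>.
  Hence \<open>(0, 0)\<close> is not in the convex hull of the projections of the other lattice points, and
  size at least seven leaves at least four cube points over \<open>(1, 0)\<close>, \<open>(0, 1)\<close>, \<open>(1, 1)\<close>. In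
  every remaining position of \<open>v\<^sub>2\<close> and \<open>v\<^sub>3\<close>, either the fibre over one of these three points
  meets \<open>x \<le> 1\<close> and contains a convex combination of the \<open>v\<^sub>i\<close> in which \<open>v\<^sub>1\<close> has weight at least
  \<open>1/4\<close>, so that \<open>x \<ge> 2\<close> there, or \<open>y - z\<close> takes only two consecutive values on the lattice points.
\<close>

section \<open>Coordinate form of the problem and its symmetries\<close>

text \<open>A predicate on three coordinates lets every symmetry of the cube be stated as another
  instance of this locale. The 4 in \<open>cube_points\<close> is 7 minus the three points outside
  the cube, and \<open>width\<close> is the assumption that the width exceeds one, expressed through
  lattice points only.\<close>

locale boxed_points =
  fixes p :: "real \<Rightarrow> real \<Rightarrow> real \<Rightarrow> bool"
    and a1 y1 z1 x2 a2 z2 x3 y3 a3 :: int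
  assumes convex_comb: "\<And>x y z x' y' z' t. p x y z \<Longrightarrow> p x' y' z' \<Longrightarrow> 0 \<le> t \<Longrightarrow> t \<le> 1 \<Longrightarrow>
      p ((1 - t) * x + t * x') ((1 - t) * y + t * y') ((1 - t) * z + t * z')"
    and v1: "p a1 y1 z1" and v2: "p x2 a2 z2" and v3: "p x3 y3 a3"
    and y1: "y1 \<in> {0, 1}" and z1: "z1 \<in> {0, 1}"
    and x2: "x2 \<in> {0, 1}" and z2: "z2 \<in> {0, 1}"
    and x3: "x3 \<in> {0, 1}" and y3: "y3 \<in> {0, 1}"
    and a1: "a1 \<notin> {0, 1}" and a2: "a2 \<notin> {0, 1}" and a3: "a3 \<notin> {0, 1}"
    and lattice_points: "\<And>(i :: int) (j :: int) (k :: int). p i j k \<Longrightarrow>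
      i \<in> {0, 1} \<and> j \<in> {0, 1} \<and> k \<in> {0, 1} \<or>
      (i, j, k) \<in> {(a1, y1, z1), (x2, a2, z2), (x3, y3, a3)}"
    and cube_points: "4 \<le> (\<Sum>i\<in>{0, 1}. \<Sum>j\<in>{0, 1}. \<Sum>k\<in>{0, 1}. of_bool (p i j k) :: nat)"
    and width: "\<And>(c1 :: int) (c2 :: int) (c3 :: int) (d :: int). (c1, c2, c3) \<noteq> (0, 0, 0) \<Longrightarrow>
      \<exists>(i :: int) (j :: int) (k :: int). p i j k \<and> c1 * i + c2 * j + c3 * k \<notin> {d, d + 1}"
begin

text \<open>Complementing x permutes 0 and 1 and sends \<open>a1\<close> to \<open>1 - a1\<close>;
  this later turns the upper bound 7 into the lower bound -6.\<close>

lemma reflect_x: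
  "boxed_points (\<lambda>x y z. p (1 - x) y z) (1 - a1) y1 z1 (1 - x2) a2 z2 (1 - x3) y3 a3"
proof
  show "p (1 - ((1 - t) * x + t * x')) ((1 - t) * y + t * y') ((1 - t) * z + t * z')"
    if "p (1 - x) y z" "p (1 - x') y' z'" "0 \<le> t" "t \<le> 1" for x y z x' y' z' t
    using convex_comb[OF that] by (simp add: algebra_simps)
  show "i \<in> {0, 1} \<and> j \<in> {0, 1} \<and> k \<in> {0, 1} \<or>
      (i, j, k) \<in> {(1 - a1, y1, z1), (1 - x2, a2, z2), (1 - x3, y3, a3)}"
    if "p (1 - real_of_int i) j k" for i j k
    using lattice_points[of "1 - i" j k] that by auto
  show "\<exists>(i :: int) (j :: int) (k :: int).
      p (1 - real_of_int i) j k \<and> c1 * i + c2 * j + c3 * k \<notin> {d, d + 1}"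
    if c: "(c1, c2, c3) \<noteq> (0, 0, 0)" for c1 c2 c3 d :: int
  proof -
    \<comment> \<open>Substituting \<open>1 - i\<close> for \<open>i\<close> negates the coefficient
      \<open>c1\<close> and leaves the constant \<open>c1\<close>, hence the shifted target
      \<open>d - c1\<close>.\<close>
    obtain i j k :: int where "p i j k" "- c1 * i + c2 * j + c3 * k \<notin> {d - c1, d - c1 + 1}"
      using width[of "- c1" c2 c3 "d - c1"] c by auto
    then show ?thesis
      by (intro exI[of _ "1 - i"] exI[of _ j] exI[of _ k]) (auto simp: algebra_simps)
  qed
  show "4 \<le> (\<Sum>i\<in>{0, 1}. \<Sum>j\<in>{0, 1}. \<Sum>k\<in>{0, 1}. of_bool (p (1 - i) j k) :: nat)"
    using cube_points by (simp del: sum_of_bool_eq)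
qed (use v1 v2 v3 y1 z1 x2 z2 x3 y3 a1 a2 a3 in auto)

lemma swap_xy: "boxed_points (\<lambda>x y z. p y x z) a2 x2 z2 y1 a1 z1 y3 x3 a3"
proof
  show "p ((1 - t) * y + t * y') ((1 - t) * x + t * x') ((1 - t) * z + t * z')"
    if "p y x z" "p y' x' z'" "0 \<le> t" "t \<le> 1" for x y z x' y' z' t
    using convex_comb[OF that] .
  show "i \<in> {0, 1} \<and> j \<in> {0, 1} \<and> k \<in> {0, 1} \<or>
      (i, j, k) \<in> {(a2, x2, z2), (y1, a1, z1), (y3, x3, a3)}"
    if "p (real_of_int j) i k" for i j k
    using lattice_points[OF that] by auto
  show "\<exists>(i :: int) (j :: int) (k :: int).
      p (real_of_int j) i k \<and> c1 * i + c2 * j + c3 * k \<notin> {d, d + 1}"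
    if c: "(c1, c2, c3) \<noteq> (0, 0, 0)" for c1 c2 c3 d :: int
  proof -
    obtain i j k :: int where "p i j k" "c2 * i + c1 * j + c3 * k \<notin> {d, d + 1}"
      using width[of c2 c1 c3 d] c by auto
    then show ?thesis
      by (intro exI[of _ j] exI[of _ i] exI[of _ k]) (auto simp: algebra_simps)
  qed
  show "4 \<le> (\<Sum>i\<in>{0, 1}. \<Sum>j\<in>{0, 1}. \<Sum>k\<in>{0, 1}. of_bool (p j i k) :: nat)"
    using cube_points by (simp del: sum_of_bool_eq)
qed (use v1 v2 v3 y1 z1 x2 z2 x3 y3 a1 a2 a3 in auto)

lemma swap_yz: "boxed_points (\<lambda>x y z. p x z y) a1 z1 y1 x3 a3 y3 x2 z2 a2"
proof
  show "p ((1 - t) * x + t * x') ((1 - t) * z + t * z') ((1 - t) * y + t * y')"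
    if "p x z y" "p x' z' y'" "0 \<le> t" "t \<le> 1" for x y z x' y' z' t
    using convex_comb[OF that] .
  show "i \<in> {0, 1} \<and> j \<in> {0, 1} \<and> k \<in> {0, 1} \<or>
      (i, j, k) \<in> {(a1, z1, y1), (x3, a3, y3), (x2, z2, a2)}"
    if "p (real_of_int i) k j" for i j k
    using lattice_points[OF that] by auto
  show "\<exists>(i :: int) (j :: int) (k :: int).
      p (real_of_int i) k j \<and> c1 * i + c2 * j + c3 * k \<notin> {d, d + 1}"
    if c: "(c1, c2, c3) \<noteq> (0, 0, 0)" for c1 c2 c3 d :: int
  proof -
    obtain i j k :: int where "p i j k" "c1 * i + c3 * j + c2 * k \<notin> {d, d + 1}"
      using width[of c1 c3 c2 d] c by auto
    then show ?thesis
      by (intro exI[of _ i] exI[of _ k] exI[of _ j]) (auto simp: algebra_simps)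
  qed
  show "4 \<le> (\<Sum>i\<in>{0, 1}. \<Sum>j\<in>{0, 1}. \<Sum>k\<in>{0, 1}. of_bool (p i k j) :: nat)"
    using cube_points by (simp del: sum_of_bool_eq)
qed (use v1 v2 v3 y1 z1 x2 z2 x3 y3 a1 a2 a3 in auto)

text \<open>The weights are not normalised, so they can be given as polynomials in the coordinates
  of the \<open>v\<close>'s. The fibre \<open>(y, z)\<close> is prescribed, and only the
  x-coordinate appears as a quotient.\<close>

lemma convex_comb3:
  assumes "p u1 u2 u3" "p v1 v2 v3" "p w1 w2 w3"
    and nonneg: "\<alpha> \<ge> 0" "\<beta> \<ge> 0" "\<gamma> \<ge> 0" and s: "s = \<alpha> + \<beta> + \<gamma>" "s > 0"
    and y: "\<alpha> * u2 + \<beta> * v2 + \<gamma> * w2 = s * y" and z: "\<alpha> * u3 + \<beta> * v3 + \<gamma> * w3 = s * z"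
  shows "p ((\<alpha> * u1 + \<beta> * v1 + \<gamma> * w1) / s) y z"
\<comment> \<open>The first two points are combined first, with total weight
  \<open>\<alpha> + \<beta>\<close>, which must be nonzero.\<close>
proof (cases "\<alpha> + \<beta> = 0")
  case True
  then have "\<alpha> = 0" "\<beta> = 0" using nonneg by auto
  then show ?thesis using assms by auto
next
  case False
  let ?r = "\<alpha> + \<beta>"
  have r: "?r > 0" using False nonneg by auto
  have "p ((1 - \<beta> / ?r) * u1 + \<beta> / ?r * v1) ((1 - \<beta> / ?r) * u2 + \<beta> / ?r * v2)
      ((1 - \<beta> / ?r) * u3 + \<beta> / ?r * v3)"
    by (rule convex_comb) (use assms r in auto)
  moreover have "0 \<le> \<gamma> / s" "\<gamma> / s \<le> 1"
    using s nonneg by auto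
  ultimately have *: "p ((1 - \<gamma> / s) * ((1 - \<beta> / ?r) * u1 + \<beta> / ?r * v1) + \<gamma> / s * w1)
      ((1 - \<gamma> / s) * ((1 - \<beta> / ?r) * u2 + \<beta> / ?r * v2) + \<gamma> / s * w2)
      ((1 - \<gamma> / s) * ((1 - \<beta> / ?r) * u3 + \<beta> / ?r * v3) + \<gamma> / s * w3)"
    using convex_comb[OF _ assms(3)] by blast
  have eq: "(1 - \<gamma> / s) * ((1 - \<beta> / ?r) * u + \<beta> / ?r * v) + \<gamma> / s * w
      = (\<alpha> * u + \<beta> * v + \<gamma> * w) / s" for u v w
  proof -
    have 1: "1 - \<gamma> / s = ?r / s" "1 - \<beta> / ?r = \<alpha> / ?r"
      using s r by (simp_all add: field_simps)
    have "\<alpha> / ?r * u + \<beta> / ?r * v = (\<alpha> * u + \<beta> * v) / ?r"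
      by (simp add: add_divide_distrib)
    then have "?r / s * (\<alpha> / ?r * u + \<beta> / ?r * v) = (\<alpha> * u + \<beta> * v) / s"
      using r by simp
    then show ?thesis unfolding 1 by (simp add: add_divide_distrib)
  qed
  show ?thesis
    using * s(2) unfolding eq y z by simp
qed

end

section \<open>The contradiction from a long \<open>v1\<close> lying on the x-axis\<close>

text \<open>These assumptions are contradictory.\<close>
locale long_boxed_points = boxed_points p a1 0 0 x2 a2 z2 x3 y3 a3
  for p a1 x2 a2 z2 x3 y3 a3 +
  assumes a1_ge: "a1 \<ge> 8"
begin

lemma fibre:
  fixes y z :: int
  assumes "p x y z" "x \<le> 1" "p x' y z" "2 \<le> x'" "y \<in> {0, 1}" "z \<in> {0, 1}"
  shows False
proof -
  \<comment> \<open>This parameter puts the point of the segment at x = 2. That would be a lattice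
    point over the unit square, where \<open>v1\<close> is the only one with x outside {0, 1}, and
    \<open>v1\<close> has x at least 8.\<close>
  define t where "t = (2 - x) / (x' - x)"
  have "p ((1 - t) * x + t * x') ((1 - t) * y + t * y) ((1 - t) * z + t * z)"
    by (rule convex_comb) (use assms in \<open>auto simp: t_def field_simps\<close>)
  moreover have "(1 - t) * x + t * x' = x + t * (x' - x)"
    by (simp add: algebra_simps)
  then have "(1 - t) * x + t * x' = of_int 2"
    using assms by (simp add: t_def)
  ultimately have "p (of_int 2) y z"
    by (simp add: algebra_simps)
  from lattice_points[OF this] show False
    using assms(5,6) a1_ge a2 a3 by auto
qed

lemma no_origin:
  assumes "p x 0 0" "x \<le> 1" shows False
  using fibre[of x 0 0 a1] assms v1 a1_ge by auto

text \<open>The point \<open>v1\<close> projects to (0, 0), so it drops out of both fibre equations.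
  Its share of at least 1/4 contributes at least 8/4 = 2 to x, while \<open>v2\<close> and
  \<open>v3\<close> contribute nonnegative amounts; \<open>fibre\<close> then applies. This is where
  the threshold 8 enters.\<close>

lemma heavy:
  fixes y z :: int and \<alpha> \<beta> \<gamma> s :: real
  assumes nonneg: "\<alpha> \<ge> 0" "\<beta> \<ge> 0" "\<gamma> \<ge> 0" and s: "s = \<alpha> + \<beta> + \<gamma>" "s > 0" and "s \<le> 4 * \<alpha>"
    and "\<beta> * a2 + \<gamma> * y3 = s * y" and "\<beta> * z2 + \<gamma> * a3 = s * z"
    and "p x y z" "x \<le> 1" "y \<in> {0, 1}" "z \<in> {0, 1}"
  shows False
proof -
  have "p ((\<alpha> * a1 + \<beta> * x2 + \<gamma> * x3) / s) y z"
    by (rule convex_comb3[OF v1 v2 v3]) (use assms in auto)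
  moreover have "\<alpha> * a1 \<ge> \<alpha> * 8"
    using a1_ge nonneg by (intro mult_left_mono) auto
  moreover have "\<beta> * x2 \<ge> 0" "\<gamma> * x3 \<ge> 0"
    using nonneg x2 x3 by auto
  then have "2 \<le> (\<alpha> * a1 + \<beta> * x2 + \<gamma> * x3) / s"
    unfolding pos_le_divide_eq[OF s(2)] using s(2) \<open>s \<le> 4 * \<alpha>\<close> \<open>\<alpha> * a1 \<ge> \<alpha> * 8\<close> by linarith
  ultimately show False
    using fibre[OF \<open>p x y z\<close> \<open>x \<le> 1\<close>] assms by blast
qed

text \<open>The counterpart of \<open>heavy\<close>: it produces the points with x at most 1 that
  \<open>fibre\<close> and \<open>no_origin\<close> exclude.\<close>

lemma convex_comb3_le:
  assumes "p u1 u2 u3" "p v1 v2 v3" "p w1 w2 w3" and le: "u1 \<le> 1" "v1 \<le> 1" "w1 \<le> 1"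
    and nonneg: "\<alpha> \<ge> 0" "\<beta> \<ge> 0" "\<gamma> \<ge> 0" and s: "s = \<alpha> + \<beta> + \<gamma>" "s > 0"
    and "\<alpha> * u2 + \<beta> * v2 + \<gamma> * w2 = s * y" and "\<alpha> * u3 + \<beta> * v3 + \<gamma> * w3 = s * z"
  obtains x where "p x y z" "x \<le> 1"
proof
  show "p ((\<alpha> * u1 + \<beta> * v1 + \<gamma> * w1) / s) y z"
    by (rule convex_comb3) (use assms in auto)
  have "\<alpha> * u1 \<le> \<alpha>" "\<beta> * v1 \<le> \<beta>" "\<gamma> * w1 \<le> \<gamma>"
    using le nonneg by (simp_all add: mult_left_le)
  then show "(\<alpha> * u1 + \<beta> * v1 + \<gamma> * w1) / s \<le> 1"
    using s by simp
qed

lemma swap_long: "long_boxed_points (\<lambda>x y z. p x z y) a1 x3 a3 y3 x2 z2 a2"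
  by (intro long_boxed_points.intro swap_yz long_boxed_points_axioms.intro a1_ge)

lemma x2_le: "real_of_int x2 \<le> 1" and x3_le: "real_of_int x3 \<le> 1"
  using x2 x3 by auto

lemma a2_cases: obtains "real_of_int a2 \<ge> 2" | "real_of_int a2 \<le> -1"
  using a2 by fastforce

lemma a3_cases: obtains "real_of_int a3 \<ge> 2" | "real_of_int a3 \<le> -1"
  using a3 by fastforce

text \<open>If \<open>z2\<close> were 0, \<open>v2\<close> would project to \<open>(a2, 0)\<close>.
  For \<open>a2\<close> \<ge> 2, (1, 0) lies between (0, 0) and \<open>(a2, 0)\<close>, with share
  \<open>(a2 - 1) / a2\<close> \<ge> 1/2 for \<open>v1\<close>. For negative \<open>a2\<close>, the
  origin lies between \<open>(a2, 0)\<close> and (1, 0).\<close>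

lemma z2_eq_1:
  assumes s: "p s 1 0" "s \<le> 1"
  shows "z2 = 1"
proof (rule ccontr)
  assume "z2 \<noteq> 1"
  then have z2: "z2 = 0" using z2 by auto
  from a2_cases show False
  proof cases
    case 1
    then show False
      by (intro heavy[of "a2 - 1" 1 0 a2 1 0 s]) (use s z2 in auto)
  next
    case 2
    have "p x2 a2 0" using v2 z2 by simp
    then obtain x where "p x 0 0" "x \<le> 1"
      by (rule convex_comb3_le[OF _ s(1) s(1) x2_le s(2) s(2),
            where \<alpha> = 1 and \<beta> = "- a2" and \<gamma> = 0 and s = "1 - a2" and y = 0 and z = 0]) (use 2 in auto)
    then show False by (rule no_origin)
  qed
qed

lemma pos_pos:
  assumes "z2 = 1" "y3 = 1" and a: "real_of_int a2 \<ge> 2" "real_of_int a3 \<ge> 2"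
    and "p s 1 1" "s \<le> 1"
  shows False
proof (rule heavy)
  \<comment> \<open>Solving for (1, 1) in terms of (0, 0), \<open>(a2, 1)\<close> and
    \<open>(1, a3)\<close> gives the weights \<open>u * v\<close>, \<open>v\<close>,
    \<open>u\<close>. Since u, v \<ge> 1, the first is at least a third of the total.\<close>
  define u v where "u = real_of_int a2 - 1" and "v = real_of_int a3 - 1"
  have "u \<ge> 1" "v \<ge> 1" using a by (auto simp: u_def v_def)
  then have "u \<le> u * v" "v \<le> u * v"
    using mult_left_mono[of 1 v u] mult_right_mono[of 1 u v] by auto
  then have "u * v + u + v \<le> 4 * (u * v)" "u * v + u + v > 0"
    using \<open>u \<ge> 1\<close> \<open>v \<ge> 1\<close> by linarith+
  moreover have "u * v + u + v = a2 * a3 - 1"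
    by (simp add: u_def v_def algebra_simps)
  ultimately show "real_of_int a2 * a3 - 1 > 0"
    "real_of_int a2 * a3 - 1 \<le> 4 * ((real_of_int a2 - 1) * (real_of_int a3 - 1))"
    by (simp_all add: u_def v_def)
  show "0 \<le> (real_of_int a2 - 1) * (real_of_int a3 - 1)"
    using a by simp
  show "real_of_int a2 * a3 - 1 = (real_of_int a2 - 1) * (real_of_int a3 - 1)
      + (real_of_int a3 - 1) + (real_of_int a2 - 1)"
    by (simp add: algebra_simps)
  show "(real_of_int a3 - 1) * a2 + (real_of_int a2 - 1) * y3 = (real_of_int a2 * a3 - 1) * of_int 1"
    "(real_of_int a3 - 1) * z2 + (real_of_int a2 - 1) * a3 = (real_of_int a2 * a3 - 1) * of_int 1"
    using assms by (simp_all add: algebra_simps)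
  show "p s (of_int 1) (of_int 1)" using assms by simp
qed (use assms in auto)

lemma neg_pos:
  assumes "z2 = 1" "y3 = 1" and a: "real_of_int a2 \<le> -1" "real_of_int a3 \<ge> 2"
    and "p s 0 1" "s \<le> 1"
  shows False
proof (rule heavy)
  \<comment> \<open>Here (0, 1) is the combination of (0, 0), \<open>(a2, 1)\<close> and
    \<open>(1, a3)\<close> with weights \<open>u * v\<close>, 1, \<open>u\<close>; again the first
    is at least a third of the total.\<close>
  define u v where "u = - real_of_int a2" and "v = real_of_int a3 - 1"
  have "u \<ge> 1" "v \<ge> 1" using a by (auto simp: u_def v_def)
  then have "u \<le> u * v"
    using mult_left_mono[of 1 v u] by auto
  then have "1 + u * v + u \<le> 4 * (u * v)" "1 + u * v + u > 0"
    using \<open>u \<ge> 1\<close> by linarith+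
  moreover have "1 + u * v + u = 1 - real_of_int a2 * a3"
    by (simp add: u_def v_def algebra_simps)
  ultimately show "1 - real_of_int a2 * a3 > 0"
    "1 - real_of_int a2 * a3 \<le> 4 * (- real_of_int a2 * (real_of_int a3 - 1))"
    by (simp_all add: u_def v_def)
  show "0 \<le> - real_of_int a2 * (real_of_int a3 - 1)"
    using \<open>u \<ge> 1\<close> \<open>v \<ge> 1\<close> unfolding u_def v_def by (intro mult_nonneg_nonneg) auto
  show "1 - real_of_int a2 * a3 = - real_of_int a2 * (real_of_int a3 - 1) + 1 + - real_of_int a2"
    by (simp add: algebra_simps)
  show "1 * real_of_int a2 + - real_of_int a2 * y3 = (1 - real_of_int a2 * a3) * of_int 0"
    "1 * real_of_int z2 + - real_of_int a2 * a3 = (1 - real_of_int a2 * a3) * of_int 1"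
    using assms by (simp_all add: algebra_simps)
  show "p s (of_int 0) (of_int 1)" using assms by simp
qed (use assms in auto)

lemma not_both_columns:
  assumes s: "p s 1 0" "s \<le> 1" and t: "p t 0 1" "t \<le> 1"
  shows False
proof -
  interpret sw: long_boxed_points "\<lambda>x y z. p x z y" a1 x3 a3 y3 x2 z2 a2
    by (rule swap_long)
  have "z2 = 1" "y3 = 1"
    using z2_eq_1[OF s] sw.z2_eq_1[OF t] .
  have q2: "p x2 a2 1" and q3: "p x3 1 a3"
    using v2 v3 \<open>z2 = 1\<close> \<open>y3 = 1\<close> by auto
  from a2_cases show False
  proof cases
    case a2: 1
    from a3_cases show False
    proof cases
      case a3: 1
      \<comment> \<open>The projection (1, 1) lies between those of the given point and of
        \<open>v3\<close>, namely (1, 0) and \<open>(1, a3)\<close>.\<close>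
      obtain x where "p x 1 1" "x \<le> 1"
        by (rule convex_comb3_le[OF s(1) s(1) q3 s(2) s(2) x3_le,
              where \<alpha> = "a3 - 1" and \<beta> = 0 and \<gamma> = 1 and s = a3 and y = 1 and z = 1])
          (use a3 in auto)
      with a2 a3 show False
        using pos_pos \<open>z2 = 1\<close> \<open>y3 = 1\<close> by blast
    next
      case 2
      with a2 show False
        using sw.neg_pos \<open>z2 = 1\<close> \<open>y3 = 1\<close> s by blast
    qed
  next
    case a2: 2
    from a3_cases show False
    proof cases
      case 1
      with a2 show False
        using neg_pos \<open>z2 = 1\<close> \<open>y3 = 1\<close> t by blast
    next
      case a3: 2
      \<comment> \<open>Now the triangle with vertices \<open>(-u, 1)\<close>,
        \<open>(1, -v)\<close> and (1, 0) contains the origin.\<close>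
      define u v where "u = - real_of_int a2" and "v = - real_of_int a3"
      have uv: "u \<ge> 1" "v \<ge> 1" using a2 a3 by (auto simp: u_def v_def)
      then have "v \<le> u * v" using mult_right_mono[of 1 u v] by auto
      with uv have "0 \<le> u * v - 1" by linarith
      obtain x where "p x 0 0" "x \<le> 1"
        by (rule convex_comb3_le[OF q2 q3 s(1) x2_le x3_le s(2),
              where \<alpha> = v and \<beta> = 1 and \<gamma> = "u * v - 1" and s = "u * v + v"
                and y = 0 and z = 0])
          (use uv \<open>0 \<le> u * v - 1\<close> in \<open>auto simp: u_def v_def algebra_simps intro: add_pos_pos\<close>)
      then show False by (rule no_origin)
    qed
  qed
qed

text \<open>No cube point lies over (0, 0). If none lay over (1, 0) either, the four required cube
  points would be exactly those with z = 1, which confines \<open>v2\<close> and \<open>v3\<close>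
  severely.\<close>

lemma some_column_10: "\<exists>s\<le>1. p s 1 0"
proof (rule ccontr)
  assume "\<not> ?thesis"
  then have no: "\<not> p 0 1 0" "\<not> p 1 1 0"
    by auto
  have "\<not> p 0 0 0" "\<not> p 1 0 0"
    using no_origin[of 0] no_origin[of 1] by auto
  with no have "4 \<le>
      of_bool (p 0 0 1) + of_bool (p 0 1 1) + of_bool (p 1 0 1) + (of_bool (p 1 1 1) :: nat)"
    using cube_points by (simp del: sum_of_bool_eq)
  then have full: "p 0 0 1" "p 0 1 1" "p 1 0 1" "p 1 1 1"
    by (auto simp: of_bool_def split: if_splits)
  from no \<open>\<not> p 0 0 0\<close> \<open>\<not> p 1 0 0\<close> have empty: "\<not> p x3 y3 0"
    using x3 y3 by auto
  \<comment> \<open>A negative \<open>a3\<close> would put \<open>(x3, y3, 0)\<close> on the segment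
    from \<open>v3\<close> to the cube point \<open>(x3, y3, 1)\<close>, contradicting
    \<open>empty\<close>.\<close>
  from a3_cases have a3_ge: "real_of_int a3 \<ge> 2"
  proof cases
    case neg: 2
    have "p x3 y3 1"
      using full x3 y3 by auto
    define t where "t = - a3 / (1 - real_of_int a3)"
    have "p ((1 - t) * x3 + t * x3) ((1 - t) * y3 + t * y3) ((1 - t) * a3 + t * 1)"
      by (rule convex_comb[OF v3 \<open>p x3 y3 1\<close>]) (use neg in \<open>auto simp: t_def field_simps\<close>)
    moreover have "(1 - t) * a3 + t * 1 = 0"
      using neg by (simp add: t_def field_simps)
    ultimately have "p x3 y3 0"
      by (simp add: algebra_simps)
    with empty show ?thesis ..
  qed
  have "y3 = 1"
  proof (rule ccontr)
    assume "y3 \<noteq> 1"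
    then have "y3 = 0" using y3 by auto
    then show False
      by (intro heavy[of "a3 - 1" 0 1 a3 0 1 0]) (use full a3_ge in auto)
  qed
  have "z2 = 0"
  proof (rule ccontr)
    assume "z2 \<noteq> 0"
    then have "z2 = 1" using z2 by auto
    from a2_cases show False
    proof cases
      case 1
      then show False using pos_pos[OF \<open>z2 = 1\<close> \<open>y3 = 1\<close> 1 a3_ge full(2)] by simp
    next
      case 2
      then show False using neg_pos[OF \<open>z2 = 1\<close> \<open>y3 = 1\<close> 2 a3_ge full(1)] by simp
    qed
  qed
  from a2_cases show False
  proof cases
    case 1
    \<comment> \<open>For (1, 1) the weights on (0, 0), \<open>(a2, 0)\<close> and
      \<open>(1, a3)\<close> are \<open>u * v\<close>, \<open>v\<close>, \<open>u + 1\<close>. The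
      share of \<open>v1\<close> is exactly 1/4 when \<open>a2 = a3 = 2\<close>.\<close>
    define u v where "u = real_of_int a2 - 1" and "v = real_of_int a3 - 1"
    have uv: "u \<ge> 1" "v \<ge> 1" using 1 a3_ge by (auto simp: u_def v_def)
    then have "u \<le> u * v" "v \<le> u * v"
      using mult_left_mono[of 1 v u] mult_right_mono[of 1 u v] by auto
    moreover have "(u + 1) * (v + 1) = u * v + u + v + 1"
      by (simp add: algebra_simps)
    ultimately have "(u + 1) * (v + 1) \<le> 4 * (u * v)"
      using uv by linarith
    then show False
      by (intro heavy[of "u * v" v "u + 1" "(u + 1) * (v + 1)" 1 1 0])
        (use full uv \<open>y3 = 1\<close> \<open>z2 = 0\<close> in \<open>auto simp: algebra_simps u_def v_def\<close>)
  next
    case 2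
    show False
    \<comment> \<open>In this exceptional case (0, 1) is the midpoint of the projections of
      \<open>v2\<close> and \<open>v3\<close>, so \<open>v1\<close> gets no weight. Instead y - z
      takes only the values -1 and 0 on lattice points, contradicting \<open>width\<close>.\<close>
    proof (cases "a2 = -1 \<and> a3 = 2")
      case True
      obtain i j k :: int where "p i j k" "0 * i + 1 * j + (-1) * k \<notin> {-1, -1 + 1}"
        using width[of 0 1 "-1" "-1"] by auto
      moreover from this have "(i, j, k) \<in> {(a1, 0, 0), (x2, -1, 0), (x3, 1, 2)} \<or>
          i \<in> {0, 1} \<and> j \<in> {0, 1} \<and> k = 1"
        using lattice_points[of i j k] no \<open>\<not> p 0 0 0\<close> \<open>\<not> p 1 0 0\<close> True \<open>y3 = 1\<close> \<open>z2 = 0\<close> by auto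
      ultimately show False by auto
    next
      case False
      \<comment> \<open>The weights for (0, 1) are \<open>u * v - u - 1\<close>, 1,
        \<open>u\<close>, with sum \<open>u * v\<close>. A share of at least 1/4 amounts to
        \<open>4 * u + 4 \<le> 3 * (u * v)\<close>.\<close>
      define u v where "u = - real_of_int a2" and "v = real_of_int a3"
      have uv: "u \<ge> 1" "v \<ge> 2" using 2 a3_ge by (auto simp: u_def v_def)
      have "u \<ge> 2 \<or> v \<ge> 3"
        using False 2 a3_ge unfolding u_def v_def by linarith
      then have "4 * u + 4 \<le> 3 * (u * v)"
      proof
        assume "u \<ge> 2"
        moreover have "u * 2 \<le> u * v" using uv by (intro mult_left_mono) auto
        ultimately show ?thesis by linarith
      next
        assume "v \<ge> 3"
        then have "u * 3 \<le> u * v" using uv by (intro mult_left_mono) auto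
        with uv show ?thesis by linarith
      qed
      moreover have "u * v > 0" using uv by simp
      ultimately show False
        by (intro heavy[of "u * v - u - 1" 1 u "u * v" 0 1 0])
          (use full uv \<open>y3 = 1\<close> \<open>z2 = 0\<close> in \<open>auto simp: algebra_simps u_def v_def\<close>)
    qed
  qed
qed

lemma impossible: False
proof -
  interpret sw: long_boxed_points "\<lambda>x y z. p x z y" a1 x3 a3 y3 x2 z2 a2
    by (rule swap_long)
  show False
    using some_column_10 sw.some_column_10 not_both_columns by blast
qed

end

section \<open>Bounds for all three coordinates by symmetry\<close>

context boxed_points
begin

lemma reflect_y:
  "boxed_points (\<lambda>x y z. p x (1 - y) z) a1 (1 - y1) z1 x2 (1 - a2) z2 x3 (1 - y3) a3"
  using boxed_points.swap_xy[OF boxed_points.reflect_x[OF swap_xy]] .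

lemma reflect_z:
  "boxed_points (\<lambda>x y z. p x y (1 - z)) a1 y1 (1 - z1) x2 a2 (1 - z2) x3 y3 (1 - a3)"
  using boxed_points.swap_yz[OF boxed_points.reflect_y[OF swap_yz]] .

lemma a1_le: "a1 \<le> 7"
proof (rule ccontr)
  assume "\<not> a1 \<le> 7"
  then have ge: "8 \<le> a1" by simp
  \<comment> \<open>Reflecting y and z where \<open>v1\<close> has coordinate 1 moves it onto the
    x-axis and keeps \<open>a1\<close>.\<close>
  obtain q x2' a2' z2' x3' y3' a3' where q: "boxed_points q a1 0 z1 x2' a2' z2' x3' y3' a3'"
  proof (cases "y1 = 0")
    case True
    then show ?thesis using that[OF boxed_points_axioms[unfolded True]] by simp
  next
    case False
    then have "1 - y1 = 0" using y1 by auto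
    then show ?thesis using that[OF reflect_y[unfolded \<open>1 - y1 = 0\<close>]] by simp
  qed
  obtain q x2' a2' z2' x3' y3' a3' where "boxed_points q a1 0 0 x2' a2' z2' x3' y3' a3'"
  proof (cases "z1 = 0")
    case True
    then show ?thesis using that[OF q[unfolded True]] by simp
  next
    case False
    then have "1 - z1 = 0" using z1 by auto
    then show ?thesis
      using that[OF boxed_points.reflect_z[OF q, unfolded \<open>1 - z1 = 0\<close>]] by simp
  qed
  then show False
    using ge by (intro long_boxed_points.impossible long_boxed_points.intro
        long_boxed_points_axioms.intro)
qed

lemma a1_bounds: "a1 \<in> {-6..7}"
  using a1_le boxed_points.a1_le[OF reflect_x] by simp

lemma a2_bounds: "a2 \<in> {-6..7}"
  by (rule boxed_points.a1_bounds[OF swap_xy])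

lemma a3_bounds: "a3 \<in> {-6..7}"
  by (rule boxed_points.a2_bounds[OF swap_yz])

end

section \<open>Lattice width and the passage from polytopes to coordinates\<close>

text \<open>A lattice polytope is the convex hull of its extreme points, which are lattice points,
  so bounds on \<open>f\<close> at lattice points extend to all of \<open>P\<close>.\<close>

lemma lattice_width_le:
  fixes f :: "real ^ 'n \<Rightarrow> real"
  assumes P: "lattice_polytope P" "P \<noteq> {}" and f: "integer_affine f" "\<not> f constant_on UNIV"
    and bound: "\<And>w. w \<in> P \<inter> int_lattice \<Longrightarrow> f w \<in> {l..u}"
  shows "lattice_width P \<le> u - l"
proof -
  have "polytope P" and extreme: "{x. x extreme_point_of P} \<subseteq> int_lattice"
    using P by (auto simp: lattice_polytope_def)
  then have compact: "compact P" and "convex P"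
    by (auto intro: polytope_imp_compact polytope_imp_convex)
  obtain g c where g: "linear g" and f_eq: "f = (\<lambda>x. g x + c)"
    using f(1) by (auto simp: integer_affine_def)
  have "convex (g -` {l - c..u - c})"
    by (intro convex_linear_vimage g) simp
  moreover have "x \<in> g -` {l - c..u - c}" if "x extreme_point_of P" for x
    using bound[of x] extreme that by (auto simp: f_eq extreme_point_of_def)
  ultimately have "convex hull {x. x extreme_point_of P} \<subseteq> g -` {l - c..u - c}"
    by (intro hull_minimal) auto
  then have "f ` P \<subseteq> {l..u}"
    using Krein_Milman_Minkowski[OF compact \<open>convex P\<close>] by (auto simp: f_eq)
  then have "Sup (f ` P) \<le> u" "l \<le> Inf (f ` P)"
    using P(2) by (auto intro!: cSup_least cInf_greatest)
  moreover have "lattice_width P \<le> Sup (f ` P) - Inf (f ` P)"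
    unfolding lattice_width_def
  proof (rule cInf_lower)
    \<comment> \<open>The infimum lies below its members only if the set is bounded below; 0 works
      because each functional is bounded on the nonempty compact set \<open>P\<close>.\<close>
    show "bdd_below {Sup (f ` P) - Inf (f ` P) |f. integer_affine f \<and> \<not> f constant_on UNIV}"
    proof (rule bdd_belowI)
      fix r assume "r \<in> {Sup (f ` P) - Inf (f ` P) |f. integer_affine f \<and> \<not> f constant_on UNIV}"
      then obtain h where h: "integer_affine h" "r = Sup (h ` P) - Inf (h ` P)"
        by auto
      then obtain g c where "linear g" "h = (\<lambda>x. g x + c)"
        by (auto simp: integer_affine_def)
      moreover from this have "continuous_on P g"
        by (simp add: linear_continuous_on linear_conv_bounded_linear)
      ultimately have "continuous_on P h"
        by (simp add: continuous_on_add)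
      then have "bounded (h ` P)"
        by (intro compact_imp_bounded compact_continuous_image compact)
      then have "Inf (h ` P) \<le> Sup (h ` P)"
        using P(2) by (intro cInf_le_cSup bounded_imp_bdd_above bounded_imp_bdd_below) auto
      then show "0 \<le> r" using h by simp
    qed
  qed (use f in blast)
  ultimately show ?thesis by linarith
qed

lemma vector_3_eq_iff:
  "(vector [x, y, z] :: real ^ 3) = vector [x', y', z'] \<longleftrightarrow> x = x' \<and> y = y' \<and> z = z'"
  by (auto simp: vec_eq_iff forall_3)

lemma vector_of_int_in_int_lattice:
  "(vector [of_int i, of_int j, of_int k] :: real ^ 3) \<in> int_lattice"
  by (simp add: int_lattice_def forall_3)

lemma int_lattice_vectorE:
  assumes "(w :: real ^ 3) \<in> int_lattice"
  obtains i j k where "w = vector [of_int i, of_int j, of_int k]"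
proof -
  have "w $ 1 \<in> \<int>" "w $ 2 \<in> \<int>" "w $ 3 \<in> \<int>"
    using assms by (auto simp: int_lattice_def)
  then obtain i j k where "w $ 1 = of_int i" "w $ 2 = of_int j" "w $ 3 = of_int k"
    by (auto elim!: Ints_cases)
  then show ?thesis
    by (intro that[of i j k]) (simp add: vec_eq_iff forall_3)
qed

lemma vector_in_unit_cube_iff:
  "vector [of_int i, of_int j, of_int k] \<in> unit_cube \<longleftrightarrow>
     i \<in> {0, 1} \<and> j \<in> {0, 1} \<and> k \<in> {0, 1}"
  by (auto simp: unit_cube_def forall_3)

theorem theorem9:
  fixes P :: "(real ^ 3) set"
    and v1 v2 v3 :: "real ^ 3"
    and a1 a2 a3 l1y l1z l2x l2z l3x l3y :: int
  assumes "lattice_polytope P" and "aff_dim P = 3"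
    and "lattice_size P \<ge> 7"
    and "boxed_unit_cube P"
    and "(P \<inter> int_lattice) - unit_cube = {v1, v2, v3}"
    and "v1 = vector [of_int a1, of_int l1y, of_int l1z]"
    and "v2 = vector [of_int l2x, of_int a2, of_int l2z]"
    and "v3 = vector [of_int l3x, of_int l3y, of_int a3]"
    and "l1y \<in> {0, 1}" and "l1z \<in> {0, 1}"
    and "l2x \<in> {0, 1}" and "l2z \<in> {0, 1}"
    and "l3x \<in> {0, 1}" and "l3y \<in> {0, 1}"
    and "a1 \<notin> {0, 1}" and "a2 \<notin> {0, 1}" and "a3 \<notin> {0, 1}"
  shows "a1 \<in> {-6, -5, -4, -3, -2, -1, 2, 3, 4, 5, 6, 7} \<and>
         a2 \<in> {-6, -5, -4, -3, -2, -1, 2, 3, 4, 5, 6, 7} \<and>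
         a3 \<in> {-6, -5, -4, -3, -2, -1, 2, 3, 4, 5, 6, 7}"
proof -
  define p where "p x y z \<longleftrightarrow> vector [x, y, z] \<in> P" for x y z
  have "convex P"
    using assms(1) by (auto simp: lattice_polytope_def intro: polytope_imp_convex)
  have in_P: "v1 \<in> P" "v2 \<in> P" "v3 \<in> P"
    using assms(5) by auto
  interpret boxed_points p a1 l1y l1z l2x a2 l2z l3x l3y a3
  proof
    show "p ((1 - t) * x + t * x') ((1 - t) * y + t * y') ((1 - t) * z + t * z')"
      if "p x y z" "p x' y' z'" "0 \<le> t" "t \<le> 1" for x y z x' y' z' t
    proof -
      have "(1 - t) *\<^sub>R vector [x, y, z] + t *\<^sub>R vector [x', y', z'] \<in> P"
        using that convexD[OF \<open>convex P\<close>] by (simp add: p_def)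
      also have "(1 - t) *\<^sub>R vector [x, y, z] + t *\<^sub>R vector [x', y', z'] =
          (vector [(1 - t) * x + t * x', (1 - t) * y + t * y', (1 - t) * z + t * z'] :: real ^ 3)"
        by (simp add: vec_eq_iff forall_3)
      finally show ?thesis by (simp add: p_def)
    qed
    show "i \<in> {0, 1} \<and> j \<in> {0, 1} \<and> k \<in> {0, 1} \<or>
        (i, j, k) \<in> {(a1, l1y, l1z), (l2x, a2, l2z), (l3x, l3y, a3)}"
      if "p (of_int i) (of_int j) (of_int k)" for i j k
    proof -
      let ?w = "vector [of_int i, of_int j, of_int k] :: real ^ 3"
      have "?w \<in> unit_cube \<or> ?w \<in> {v1, v2, v3}"
        using that assms(5) vector_of_int_in_int_lattice[of i j k] by (auto simp: p_def)
      then show ?thesis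
        by (simp add: vector_in_unit_cube_iff assms(6-8) vector_3_eq_iff)
    qed
    show "4 \<le> (\<Sum>i\<in>{0, 1}. \<Sum>j\<in>{0, 1}. \<Sum>k\<in>{0, 1}. of_bool (p i j k) :: nat)"
    proof -
      \<comment> \<open>The cube points of \<open>P\<close> are counted as coordinate triples; all
        other lattice points are among \<open>v1\<close>, \<open>v2\<close>,
        \<open>v3\<close>.\<close>
      define T where "T = {(i, j, k) \<in> {0, 1} \<times> {0, 1} \<times> {0, 1}. p i j k}"
      have "finite T"
        by (rule finite_subset[of _ "{0, 1} \<times> {0, 1} \<times> {0, 1}"]) (auto simp: T_def)
      have "P \<inter> int_lattice \<subseteq> (\<lambda>(i, j, k). vector [i, j, k]) ` T \<union> {v1, v2, v3}"
      proof
        fix w assume w: "w \<in> P \<inter> int_lattice"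
        then obtain i j k where w_eq: "w = vector [of_int i, of_int j, of_int k]"
          by (auto elim: int_lattice_vectorE)
        show "w \<in> (\<lambda>(i, j, k). vector [i, j, k]) ` T \<union> {v1, v2, v3}"
        proof (cases "w \<in> unit_cube")
          case True
          then have "(of_int i, of_int j, of_int k) \<in> T"
            using w by (auto simp: w_eq vector_in_unit_cube_iff T_def p_def)
          then show ?thesis using w_eq by force
        qed (use w assms(5) in blast)
      qed
      then have "card (P \<inter> int_lattice)
          \<le> card ((\<lambda>(i, j, k). vector [i, j, k] :: real ^ 3) ` T \<union> {v1, v2, v3})"
        using \<open>finite T\<close> by (intro card_mono) auto
      also have "\<dots> \<le> card T + 3"
        by (intro order.trans[OF card_Un_le] add_mono card_image_le \<open>finite T\<close>)
          (simp add: card_insert_if)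
      finally have "4 \<le> card T"
        using assms(3) by (simp add: lattice_size_def)
      also have "card T = (\<Sum>(i, j, k)\<in>{0, 1} \<times> {0, 1} \<times> {0, 1}. of_bool (p i j k))"
        by (simp add: T_def case_prod_unfold Int_def del: insert_iff)
      also have "\<dots> = (\<Sum>i\<in>{0, 1}. \<Sum>j\<in>{0, 1}. \<Sum>k\<in>{0, 1}. of_bool (p i j k))"
        by (simp add: sum.cartesian_product del: sum_of_bool_eq)
      finally show ?thesis .
    qed
    show "\<exists>(i :: int) (j :: int) (k :: int). p i j k \<and> c1 * i + c2 * j + c3 * k \<notin> {d, d + 1}"
      if c: "(c1, c2, c3) \<noteq> (0, 0, 0)" for c1 c2 c3 d :: int
    proof (rule ccontr)
      assume flat: "\<not> ?thesis"
      \<comment> \<open>A functional with only the values \<open>d\<close> and \<open>d + 1\<close>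
        on lattice points would force width at most 1.\<close>
      define f where "f w = c1 * w $ 1 + c2 * w $ 2 + c3 * w $ 3" for w :: "real ^ 3"
      have "linear f"
        by (auto simp: f_def algebra_simps intro!: linearI)
      have f_int: "f (vector [of_int i, of_int j, of_int k]) = of_int (c1 * i + c2 * j + c3 * k)"
        for i j k
        by (simp add: f_def)
      have "integer_affine f"
        unfolding integer_affine_def
      proof
        show "\<exists>g c. linear g \<and> f = (\<lambda>x. g x + c)"
          using \<open>linear f\<close> by (intro exI[of _ f] exI[of _ 0]) simp
        show "f ` int_lattice \<subseteq> \<int>"
          by (auto elim!: int_lattice_vectorE simp only: f_int Ints_of_int)
      qed
      moreover have "\<not> f constant_on UNIV"
      proof
        assume "f constant_on UNIV"
        then have "f w = f 0" for w
          by (auto simp: constant_on_def)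
        from this[of "vector [1, 0, 0]"] this[of "vector [0, 1, 0]"] this[of "vector [0, 0, 1]"]
        show False using c by (simp add: f_def)
      qed
      moreover have "f w \<in> {d..d + 1}" if w: "w \<in> P \<inter> int_lattice" for w
      proof -
        obtain i j k where "w = vector [of_int i, of_int j, of_int k]"
          using w by (auto elim: int_lattice_vectorE)
        moreover from this have "c1 * i + c2 * j + c3 * k \<in> {d, d + 1}"
          using flat w unfolding p_def by blast
        ultimately show ?thesis
          by (auto simp: f_int simp del: of_int_add of_int_mult)
      qed
      ultimately have "lattice_width P \<le> of_int (d + 1) - of_int d"
        using assms(1) in_P by (intro lattice_width_le) auto
      then show False
        using assms(4) by (simp add: boxed_unit_cube_def)
    qed
  qed (use in_P assms(6-17) in \<open>auto simp: p_def\<close>)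
  show ?thesis
    using a1_bounds a2_bounds a3_bounds a1 a2 a3 by auto presburger+
qed

end
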